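(* Let $N\ge2$, $s\in(0,1)$ and let $k<N$ be a positive integer. Then for any $p>0$ there exists a nonnegative viscosity supersolution $u\in C^{0,s}(\mathbb{R}^N)\cap L^\infty(\mathbb{R}^N)$ of $$\mathcal I_k^-u(x)+u^p(x)=0\quad\text{in }\mathbb{R}^N_+$$ such that $u(x)=0$ for all $x\in\mathbb{R}^N\setminus\mathbb{R}^N_+$ and $$\limsup_{x_N\to+\infty}u(x',x_N)>0\quad\text{uniformly with respect to }x'\in\mathbb{R}^{N-1},$$ i.e. there is a constant $c>0$ such that $\limsup_{x_N\to+\infty}u(x',x_N)\ge c$ for every $x'\in\mathbb{R}^{N-1}$.
   Context: $\mathbb{R}^N_+=\{x=(x',x_N)\in\mathbb{R}^{N-1}\times\mathbb{R}: x_N>0\}$. $C^{0,s}(\mathbb{R}^N)$ is the space of $s$-Hölder continuous functions. For a unit vector $\xi\in\mathbb{R}^N$, $$\mathcal I_\xi u(x)=C_s\int_0^{+\infty}\frac{u(x+\tau\xi)+u(x-\tau\xi)-2u(x)}{\tau^{1+2s}}\,d\tau,$$ where $C_s>0$ is a normalizing constant depending only on $s$ (chosen so that $\mathcal I_\xi u(x)\to\langle D^2u(x)\xi,\xi\rangle$ as $s\to1^-$). $\mathcal V_k$ is the set of $k$-element orthonormal families $\{\xi_1,\dots,\xi_k\}$ in $\mathbb{R}^N$, and $\mathcal I_k^-u(x)=\inf_{\{\xi_i\}\in\mathcal V_k}\sum_{i=1}^k\mathcal I_{\xi_i}u(x)$. $\mathcal S$ is the space of functions $u:\mathbb{R}^N\to\mathbb{R}$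 such that (i) for every $x\in\mathbb{R}^N_+$ and unit vector $\xi$, the map $\tau\in\mathbb{R}\mapsto u(x+\tau\xi)$ is measurable; (ii) there are $\alpha\in[0,2s)$ and $C>0$ with $|u(x)|\le C(1+|x|)^\alpha$ for all $x\in\mathbb{R}^N$. $LSC(\mathbb{R}^N_+)$ means lower semicontinuous on $\mathbb{R}^N_+$. Viscosity supersolution: $u\in\mathcal S\cap LSC(\mathbb{R}^N_+)$ is a viscosity supersolution of $\mathcal I u+u^p=0$ in $\mathbb{R}^N_+$ if for every $x_0\in\mathbb{R}^N_+$, $r>0$ with $B_r(x_0)\subseteq\mathbb{R}^N_+$ and $\varphi\in C^2(\overline{B_r(x_0)})$ with $\varphi(x_0)=u(x_0)$ and $\varphi\le u$ in $B_r(x_0)$, the function $\psi$ equal to $\varphi$ in $B_r(x_0)$ and to $u$ in $\mathbb{R}^N\setminus B_r(x_0)$ satisfies $\mathcal I\psi(x_0)+u(x_0)^p\le 0$. *)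

theory Defs
  imports "HOL-Analysis.Analysis"
begin

text \<open>Points of \<open>\<real>\<^sup>N\<close> are written \<open>(x', x\<^sub>N)\<close> with \<open>x'\<close> in a Euclidean space of dimension
  \<open>N - 1\<close>; the norm of the product type is the Euclidean one.\<close>

definition half_space :: "('a::euclidean_space \<times> real) set" where
  "half_space = {x. snd x > 0}"

text \<open>The parameter \<open>c\<close> is the constant \<open>C\<^sub>s\<close> in front of the integral.\<close>

definition dir_op :: "real \<Rightarrow> real \<Rightarrow> 'a::euclidean_space \<Rightarrow> ('a \<Rightarrow> real) \<Rightarrow> 'a \<Rightarrow> real" where
  "dir_op c s \<xi> u x =
     c * (LINT \<tau>:{0<..}|lebesgue.
            (u (x + \<tau> *\<^sub>R \<xi>) + u (x - \<tau> *\<^sub>R \<xi>) - 2 * u x) / \<tau> powr (1 + 2 * s))"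

definition orthonormal_families :: "nat \<Rightarrow> 'a::euclidean_space set set" where
  "orthonormal_families k =
     {B. finite B \<and> card B = k \<and> pairwise orthogonal B \<and> (\<forall>\<xi>\<in>B. norm \<xi> = 1)}"

text \<open>The infimum is taken in \<open>\<real>\<close>. For functions that are \<open>C\<^sup>2\<close> up to the boundary of a ball around
  \<open>x\<close> and grow more slowly than \<open>\<bar>x\<bar>\<^bsup>2s\<^esup>\<close>, the sums are bounded uniformly over the families,
  and the set of families is nonempty whenever \<open>k\<close> is at most the dimension.\<close>

definition inf_op :: "real \<Rightarrow> real \<Rightarrow> nat \<Rightarrow> ('a::euclidean_space \<Rightarrow> real) \<Rightarrow> 'a \<Rightarrow> real" where
  "inf_op c s k u x = (INF B\<in>orthonormal_families k. \<Sum>\<xi>\<in>B. dir_op c s \<xi> u x)"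

text \<open>\<open>\<phi>\<close> is twice continuously differentiable in the open set \<open>U\<close>, and \<open>\<phi>\<close>, its gradient and its
  Hessian extend continuously to the closure of \<open>U\<close>; \<open>D\<close> and \<open>H\<close> are these extensions.\<close>

definition C2_derivs ::
  "'a::euclidean_space set \<Rightarrow> ('a \<Rightarrow> real) \<Rightarrow> ('a \<Rightarrow> 'a \<Rightarrow>\<^sub>L real) \<Rightarrow> ('a \<Rightarrow> 'a \<Rightarrow>\<^sub>L ('a \<Rightarrow>\<^sub>L real)) \<Rightarrow> bool"
where
  "C2_derivs U \<phi> D H \<longleftrightarrow>
     continuous_on (closure U) \<phi> \<and> continuous_on (closure U) D \<and> continuous_on (closure U) H \<and>
     (\<forall>x\<in>U. (\<phi> has_derivative blinfun_apply (D x)) (at x) \<and>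
            (D has_derivative blinfun_apply (H x)) (at x))"

definition C2_closure :: "'a::euclidean_space set \<Rightarrow> ('a \<Rightarrow> real) \<Rightarrow> bool" where
  "C2_closure U \<phi> \<longleftrightarrow> (\<exists>D H. C2_derivs U \<phi> D H)"

text \<open>The normalization of \<open>s \<mapsto> C\<^sub>s\<close>: positivity, and convergence of \<open>\<I>\<^sub>\<xi> u(x)\<close> to
  \<open>\<langle>D\<^sup>2u(x)\<xi>, \<xi>\<rangle>\<close> as \<open>s\<close> tends to 1 from below, for bounded \<open>C\<^sup>2\<close> functions \<open>u\<close>. This does not
  determine \<open>C\<^sub>s\<close> for an individual \<open>s\<close>. The type argument fixes the ambient space.\<close>

definition normalizing :: "'a::euclidean_space itself \<Rightarrow> (real \<Rightarrow> real) \<Rightarrow> bool" where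
  "normalizing T C \<longleftrightarrow>
     (\<forall>s. 0 < s \<and> s < 1 \<longrightarrow> C s > 0) \<and>
     (\<forall>(u :: 'a \<Rightarrow> real) D H x \<xi>.
        bounded (range u) \<and> C2_derivs UNIV u D H \<and> norm \<xi> = 1 \<longrightarrow>
        ((\<lambda>s. dir_op (C s) s \<xi> u x) \<longlongrightarrow> H x \<xi> \<xi>) (at_left 1))"

definition class_S :: "real \<Rightarrow> ('a::euclidean_space \<times> real \<Rightarrow> real) set" where
  "class_S s =
     {u. (\<forall>x\<in>half_space. \<forall>\<xi>. norm \<xi> = 1 \<longrightarrow>
            (\<lambda>\<tau>. u (x + \<tau> *\<^sub>R \<xi>)) \<in> borel_measurable lebesgue) \<and>
         (\<exists>\<alpha> K. 0 \<le> \<alpha> \<and> \<alpha> < 2 * s \<and> K > 0 \<and> (\<forall>x. \<bar>u x\<bar> \<le> K * (1 + norm x) powr \<alpha>))}"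

definition LSC :: "'a::topological_space set \<Rightarrow> ('a \<Rightarrow> real) set" where
  "LSC U = {u. \<forall>x\<in>U. \<forall>l < u x. \<forall>\<^sub>F y in at x within U. l < u y}"

definition viscosity_supersolution ::
  "real \<Rightarrow> (('a::euclidean_space \<times> real \<Rightarrow> real) \<Rightarrow> 'a \<times> real \<Rightarrow> real) \<Rightarrow> real
     \<Rightarrow> ('a \<times> real \<Rightarrow> real) \<Rightarrow> bool"
where
  "viscosity_supersolution s I p u \<longleftrightarrow>
     u \<in> class_S s \<inter> LSC half_space \<and>
     (\<forall>x0\<in>half_space. \<forall>r>0. \<forall>\<phi>.
        ball x0 r \<subseteq> half_space \<and> C2_closure (ball x0 r) \<phi> \<and> \<phi> x0 = u x0 \<and>
        (\<forall>x\<in>ball x0 r. \<phi> x \<le> u x) \<longrightarrow>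
        I (\<lambda>x. if x \<in> ball x0 r then \<phi> x else u x) x0 + u x0 powr p \<le> 0)"

definition holder_space :: "real \<Rightarrow> ('a::metric_space \<Rightarrow> real) set" where
  "holder_space s = {u. \<exists>L. \<forall>x y. \<bar>u x - u y\<bar> \<le> L * dist x y powr s}"

definition L_infty :: "('a::euclidean_space \<Rightarrow> real) set" where
  "L_infty = {u. u \<in> borel_measurable lebesgue \<and> (\<exists>M. AE x in lebesgue. \<bar>u x\<bar> \<le> M)}"

end

theory Submission
  imports Defs
begin

text \<open>The supersolution depends on \<open>x\<^sub>N\<close> only: it is a periodic row of equal bumps
  \<open>(\<rho> - |x\<^sub>N - 4\<rho>n|)\<^sub>+\<^sup>s\<close>. Where it vanishes, \<open>k < N\<close> horizontal directions give
  nonpositive operators. Inside a bump one uses \<open>e\<^sub>N\<close> and \<open>k - 1\<close> horizontal directions: towards the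
  nearer edge the bump lies below the half-line profile \<open>y\<^sub>+\<^sup>s\<close>, whose one-dimensional fractional
  Laplacian vanishes, and cutting this profile off at distance \<open>2\<rho>\<close> gains a negative constant of
  order \<open>\<rho>\<^bsup>-s\<^esup>\<close>, uniformly up to the edge. For small \<open>\<rho>\<close> this beats \<open>u\<^sup>p \<le> 1\<close>.\<close>

section \<open>The fractional Laplacian of the half-line profile\<close>

lemma powr_tail_integral:
  fixes a e :: real
  assumes "1 < e" "0 < a"
  shows "set_integrable lebesgue {a..} (\<lambda>\<tau>. 1 / \<tau> powr e)"
    and "(LINT \<tau>:{a..}|lebesgue. 1 / \<tau> powr e) = a powr (1 - e) / (e - 1)"
proof -
  have "((\<lambda>\<tau>. \<tau> powr (-e)) has_integral (- (a powr (- e + 1)) / (- e + 1))) {a..}"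
    by (rule has_integral_powr_to_inf) (use assms in auto)
  also have "- (a powr (- e + 1)) / (- e + 1) = a powr (1 - e) / (e - 1)"
    using assms by (simp add: field_simps)
  finally have i: "((\<lambda>\<tau>. 1 / \<tau> powr e) has_integral (a powr (1 - e) / (e - 1))) {a..}"
    by (simp add: powr_minus_divide)
  show *: "set_integrable lebesgue {a..} (\<lambda>\<tau>. 1 / \<tau> powr e)"
    by (rule nonnegative_absolutely_integrable_1) (use i in auto)
  show "(LINT \<tau>:{a..}|lebesgue. 1 / \<tau> powr e) = a powr (1 - e) / (e - 1)"
    using set_lebesgue_integral_eq_integral(2)[OF *] i by (simp add: integral_unique)
qed

text \<open>The substitution \<open>\<tau> = \<sigma> / (1 - \<sigma>)\<close> (the Kelvin transform \<open>y \<mapsto> 1/y\<close> with \<open>y = 1 + \<tau>\<close>) folds the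
  outer half of the fractional Laplacian of \<open>y\<^sub>+\<^sup>s\<close> at \<open>y = 1\<close> onto \<open>(0, 1)\<close>. Only for the exponent
  \<open>s\<close> the resulting integrand has this elementary antiderivative.\<close>

lemma kelvin_antiderivative:
  fixes s \<sigma> :: real
  assumes "0 < s" "0 < \<sigma>" "\<sigma> < 1"
  shows "((\<lambda>\<sigma>. (1 - (1 - \<sigma>) powr s)\<^sup>2 / (2 * s * \<sigma> powr (2 * s))) has_real_derivative
    (1 - (1 - \<sigma>) powr s) * ((1 - \<sigma>) powr (s - 1) - 1) / \<sigma> powr (1 + 2 * s)) (at \<sigma>)"
proof -
  define A where "A = (1 - \<sigma>) powr s"
  define B where "B = \<sigma> powr (2 * s)"
  have A1: "(1 - \<sigma>) powr (s - 1) = A / (1 - \<sigma>)"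
    using assms by (simp add: A_def powr_diff)
  have B1: "\<sigma> powr (2 * s - 1) = B / \<sigma>" "\<sigma> powr (1 + 2 * s) = \<sigma> * B"
    using assms by (simp_all add: B_def powr_diff powr_add)
  have B0: "B \<noteq> 0" "B > 0" using assms by (simp_all add: B_def)
  have "((\<lambda>\<sigma>. (1 - (1 - \<sigma>) powr s)\<^sup>2 / (2 * s * \<sigma> powr (2 * s))) has_real_derivative
    ((2 * (1 - A) * (s * (1 - \<sigma>) powr (s - 1))) * (2 * s * B)
       - (1 - A)\<^sup>2 * (2 * s * (2 * s * \<sigma> powr (2 * s - 1)))) / (2 * s * B)\<^sup>2) (at \<sigma>)"
    using assms
    by (auto intro!: derivative_eq_intros simp: A_def B_def power2_eq_square)
  moreover have "((2 * (1 - A) * (s * (1 - \<sigma>) powr (s - 1))) * (2 * s * B)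
       - (1 - A)\<^sup>2 * (2 * s * (2 * s * \<sigma> powr (2 * s - 1)))) / (2 * s * B)\<^sup>2
     = (1 - A) * (A / (1 - \<sigma>) - 1) / (\<sigma> * B)"
    unfolding A1 B1 using assms B0 by (simp add: divide_simps power2_eq_square) algebra
  ultimately show ?thesis unfolding A1 B1 A_def[symmetric] by simp
qed

text \<open>The bound tends to 0 with \<open>\<epsilon>\<close>; it is the defect caused by the inversion not preserving the
  symmetric truncation at distance \<open>\<epsilon>\<close>.\<close>

lemma half_line_truncated:
  fixes s \<epsilon> :: real
  assumes s: "0 < s" "s < 1" and e: "0 < \<epsilon>"
  defines "f \<equiv> \<lambda>\<tau>. ((1 + \<tau>) powr s + max 0 (1 - \<tau>) powr s - 2) / \<tau> powr (1 + 2 * s)"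
  shows "set_integrable lebesgue {\<epsilon>..} f"
    and "(LINT \<tau>:{\<epsilon>..}|lebesgue. f \<tau>) \<le> \<epsilon> powr (2 - 2 * s) * (1 + \<epsilon>) powr (2 * s)"
proof -
  \<comment> \<open>\<open>a\<close> is the point that the substitution sends to \<epsilon>:
    \<open>a / (1 - a) = \<epsilon>\<close>.\<close>
  define a where "a = \<epsilon> / (1 + \<epsilon>)"
  have a: "0 < a" "a < 1" "a < \<epsilon>" using e by (auto simp: a_def field_simps)
  \<comment> \<open>\<open>f1\<close> is the outward gain and \<open>b\<close> the inward loss, so
    \<open>f = f1 - b\<close>. The substitution turns \<open>f1\<close> on
    \<open>{\<epsilon>..}\<close> into \<open>q + b\<close> on \<open>{a..<1}\<close>, where
    \<open>q\<close> has the antiderivative \<open>Phi\<close>.\<close>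
  define q where "q = (\<lambda>\<sigma>::real. (1 - (1 - \<sigma>) powr s) * ((1 - \<sigma>) powr (s - 1) - 1) / \<sigma> powr (1 + 2 * s))"
  define b where "b = (\<lambda>\<sigma>::real. (1 - max 0 (1 - \<sigma>) powr s) / \<sigma> powr (1 + 2 * s))"
  define f1 where "f1 = (\<lambda>\<sigma>::real. ((1 + \<sigma>) powr s - 1) / \<sigma> powr (1 + 2 * s))"
  define Phi where "Phi = (\<lambda>\<sigma>::real. (1 - (1 - \<sigma>) powr s)\<^sup>2 / (2 * s * \<sigma> powr (2 * s)))"
  let ?K = "\<lambda>\<tau>::real. 1 / \<tau> powr (1 + 2 * s)"
  have fb: "f = (\<lambda>\<sigma>. f1 \<sigma> - b \<sigma>)"
    by (auto simp: f_def f1_def b_def field_simps diff_divide_distrib add_divide_distrib)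
  have K: "set_integrable lebesgue {a..} ?K" "(LINT \<tau>:{1..}|lebesgue. ?K \<tau>) = 1 / (2 * s)"
    using powr_tail_integral[of "1 + 2 * s" a] powr_tail_integral[of "1 + 2 * s" 1] s a by auto
  have b_int: "set_integrable lebesgue {a..} b"
  proof (rule set_integrable_bound[OF K(1)])
    show "set_borel_measurable lebesgue {a..} b"
      unfolding set_borel_measurable_def b_def
      by (intro measurable_completion) measurable
    show "AE x in lebesgue. x \<in> {a..} \<longrightarrow> norm (b x) \<le> norm (1 / x powr (1 + 2 * s))"
    proof (intro AE_I2 impI)
      fix x assume x: "x \<in> {a..}"
      have "max 0 (1 - x) powr s \<le> 1 powr s"
        using a s x by (intro powr_mono2) auto
      then show "norm (b x) \<le> norm (1 / x powr (1 + 2 * s))"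
        by (auto simp: b_def intro!: divide_right_mono)
    qed
  qed
  \<comment> \<open>\<open>q\<close> blows up as \<sigma> tends to 1, but \<open>Phi\<close> stays
    continuous there, so differentiability is required only in the interior.\<close>
  have "(q has_integral (Phi 1 - Phi a)) {a..1}"
    unfolding q_def
  proof (rule fundamental_theorem_of_calculus_interior)
    show "continuous_on {a..1} Phi"
      unfolding Phi_def using a s
      by (intro continuous_intros continuous_on_powr') auto
  qed (use a s in \<open>auto simp: Phi_def has_real_derivative_iff_has_vector_derivative[symmetric] intro!: kelvin_antiderivative\<close>)
  \<comment> \<open>The endpoint is removed because \<open>0 powr (s - 1) = 0\<close> makes
    \<open>q 1 = -1\<close>, which would spoil the sign of \<open>q\<close>; the substitution is
    singular there as well.\<close>
  then have q_has: "(q has_integral (Phi 1 - Phi a)) {a..<1}"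
    by (subst (asm) has_integral_spike_set_eq[where T="{a..<1}"]) (auto intro: negligible_subset[of "{1}"])
  have q_nonneg: "0 \<le> q x" if "x \<in> {a..<1}" for x
  proof -
    have x: "0 < x" "x < 1" using that a by auto
    have "(1 - x) powr s \<le> 1 powr s" using x s by (intro powr_mono2) auto
    moreover have "1 powr (s - 1) \<le> (1 - x) powr (s - 1)" using x s by (intro powr_mono2') auto
    ultimately show ?thesis by (simp add: q_def)
  qed
  have q_int: "set_integrable lebesgue {a..<1} q"
    by (rule nonnegative_absolutely_integrable_1) (use q_has q_nonneg in auto)
  have q_val: "(LINT \<tau>:{a..<1}|lebesgue. q \<tau>) \<le> 1 / (2 * s)"
  proof -
    have "Phi a \<ge> 0" using s by (simp add: Phi_def)
    moreover have "Phi 1 = 1 / (2 * s)" by (simp add: Phi_def)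
    ultimately show ?thesis
      using set_lebesgue_integral_eq_integral(2)[OF q_int] q_has by (simp add: integral_unique)
  qed
  define g where "g = (\<lambda>\<sigma>::real. \<sigma> / (1 - \<sigma>))"
  have g_image: "g ` {a..<1} = {\<epsilon>..}"
  proof (intro equalityI subsetI)
    fix y assume "y \<in> g ` {a..<1}"
    then show "y \<in> {\<epsilon>..}" using e by (auto simp: g_def a_def field_simps)
  next
    fix y assume y: "y \<in> {\<epsilon>..}"
    then have "y = g (y / (1 + y))" "y / (1 + y) \<in> {a..<1}"
      using e by (auto simp: g_def a_def field_simps)
    then show "y \<in> g ` {a..<1}" by blast
  qed
  have hqb: "\<bar>1 / (1 - \<sigma>)\<^sup>2\<bar> * f1 (g \<sigma>) = q \<sigma> + b \<sigma>" if "\<sigma> \<in> {a..<1}" for \<sigma>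
  proof -
    define y where "y = 1 - \<sigma>"
    define Y where "Y = y powr s"
    define Z where "Z = \<sigma> powr (2 * s)"
    have y: "0 < y" "0 < \<sigma>" using that a by (auto simp: y_def)
    have Y: "Y > 0" "Z > 0" using y by (auto simp: Y_def Z_def)
    have "1 + g \<sigma> = 1 / y" using y by (simp add: g_def y_def field_simps)
    then have 1: "(1 + g \<sigma>) powr s = 1 / Y" by (simp add: Y_def powr_divide)
    have "y powr (2 * s) = Y * Y" by (simp add: Y_def flip: powr_add)
    then have 2: "g \<sigma> powr (1 + 2 * s) = \<sigma> * Z / (y * Y * Y)"
      using y by (simp add: g_def y_def[symmetric] powr_divide powr_add Z_def)
    have 3: "y powr (s - 1) = Y / y" "\<sigma> powr (1 + 2 * s) = \<sigma> * Z" "max 0 y = y" "y powr s = Y"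
      using y by (simp_all add: Y_def Z_def powr_add powr_diff)
    have "y\<^sup>2 * (\<sigma> * Z) \<noteq> 0" using y Y by simp
    then show ?thesis
      unfolding f1_def q_def b_def 1 2 y_def[symmetric] unfolding 3 using y Y
      by (simp add: divide_simps power2_eq_square) (simp add: algebra_simps)
  qed
  \<comment> \<open>Read from left to right, the equivalence transfers integrability too: that of
    \<open>q + b\<close> on a bounded interval gives that of \<open>f1\<close> up to
    infinity.\<close>
  have cov: "(\<lambda>\<sigma>. \<bar>1 / (1 - \<sigma>)\<^sup>2\<bar> * f1 (g \<sigma>)) absolutely_integrable_on {a..<1} \<and>
           integral {a..<1} (\<lambda>\<sigma>. \<bar>1 / (1 - \<sigma>)\<^sup>2\<bar> * f1 (g \<sigma>)) = c
     \<longleftrightarrow> f1 absolutely_integrable_on (g ` {a..<1}) \<and> integral (g ` {a..<1}) f1 = c" for c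
  proof (rule has_absolute_integral_change_of_variables_1')
    show "(g has_real_derivative 1 / (1 - \<sigma>)\<^sup>2) (at \<sigma> within {a..<1})" if "\<sigma> \<in> {a..<1}" for \<sigma>
      unfolding g_def using that
      by (auto intro!: derivative_eq_intros simp: power2_eq_square)
    show "inj_on g {a..<1}"
      by (auto simp: inj_on_def g_def field_simps)
  qed auto
  have b_sub: "set_integrable lebesgue S b" if "S \<in> sets lebesgue" "S \<subseteq> {a..}" for S
    using set_integrable_subset[OF b_int] that by blast
  have b1: "set_integrable lebesgue {a..<1} b" by (rule b_sub) auto
  have qb_int: "set_integrable lebesgue {a..<1} (\<lambda>\<sigma>. q \<sigma> + b \<sigma>)"
    by (intro set_integral_add q_int b1)
  have "set_integrable lebesgue {a..<1} (\<lambda>\<sigma>. \<bar>1 / (1 - \<sigma>)\<^sup>2\<bar> * f1 (g \<sigma>))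
      = set_integrable lebesgue {a..<1} (\<lambda>\<sigma>. q \<sigma> + b \<sigma>)"
    by (rule set_integrable_cong[OF refl refl hqb])
  with qb_int have "set_integrable lebesgue {a..<1} (\<lambda>\<sigma>. \<bar>1 / (1 - \<sigma>)\<^sup>2\<bar> * f1 (g \<sigma>))"
    by simp
  moreover have "integral {a..<1} (\<lambda>\<sigma>. \<bar>1 / (1 - \<sigma>)\<^sup>2\<bar> * f1 (g \<sigma>))
      = (LINT \<tau>:{a..<1}|lebesgue. q \<tau> + b \<tau>)"
    unfolding set_lebesgue_integral_eq_integral(2)[OF qb_int]
    by (rule integral_cong) (use hqb in auto)
  ultimately have f1_int: "set_integrable lebesgue {\<epsilon>..} f1"
    and "integral {\<epsilon>..} f1 = (LINT \<tau>:{a..<1}|lebesgue. q \<tau> + b \<tau>)"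
    using cov[unfolded g_image, of "LINT \<tau>:{a..<1}|lebesgue. q \<tau> + b \<tau>"] by auto
  then have f1_val: "(LINT \<tau>:{\<epsilon>..}|lebesgue. f1 \<tau>)
      = (LINT \<tau>:{a..<1}|lebesgue. q \<tau>) + (LINT \<tau>:{a..<1}|lebesgue. b \<tau>)"
    using set_lebesgue_integral_eq_integral(2)[OF f1_int] set_integral_add(2)[OF q_int b1]
    by simp
  have be: "set_integrable lebesgue {\<epsilon>..} b" using a by (intro b_sub) auto
  show "set_integrable lebesgue {\<epsilon>..} f"
    unfolding fb using f1_int be by (rule set_integral_diff)
  have split: "(LINT \<tau>:{a..}|lebesgue. b \<tau>)
      = (LINT \<tau>:{a..<c}|lebesgue. b \<tau>) + (LINT \<tau>:{c..}|lebesgue. b \<tau>)" if "a \<le> c" for c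
  proof -
    have "{a..} = {a..<c} \<union> {c..}" using that by auto
    then show ?thesis using that by (auto intro!: set_integral_Un b_sub)
  qed
  \<comment> \<open>From distance 1 on, the inward point has left the half-line and \<open>b\<close>
    is the bare kernel. Its mass \<open>1 / (2 * s)\<close> equals \<open>Phi 1\<close> and thus
    compensates the integral of \<open>q\<close>.\<close>
  have "(LINT \<tau>:{1..}|lebesgue. b \<tau>) = (LINT \<tau>:{1..}|lebesgue. ?K \<tau>)"
    using s by (intro set_lebesgue_integral_cong) (auto simp: b_def)
  \<comment> \<open>The two copies of \<open>b\<close>, on \<open>{a..<1}\<close> and on
    \<open>{\<epsilon>..}\<close>, cancel up to the tail \<open>{1..}\<close> and the mismatch
    \<open>{a..<\<epsilon>}\<close> of the truncations.\<close>
  then have "(LINT \<tau>:{\<epsilon>..}|lebesgue. f \<tau>)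
      = (LINT \<tau>:{a..<1}|lebesgue. q \<tau>) - 1 / (2 * s) + (LINT \<tau>:{a..<\<epsilon>}|lebesgue. b \<tau>)"
    unfolding fb set_integral_diff(2)[OF f1_int be] f1_val
    using split[of 1] split[of \<epsilon>] a K(2) by simp
  also have "\<dots> \<le> (LINT \<tau>:{a..<\<epsilon>}|lebesgue. b \<tau>)" using q_val by simp
  also have "\<dots> \<le> (LINT \<tau>:{a..<\<epsilon>}|lebesgue. \<epsilon> / a powr (1 + 2 * s))"
  proof (rule set_integral_mono)
    show "set_integrable lebesgue {a..<\<epsilon>} b" by (rule b_sub) auto
    show "set_integrable lebesgue {a..<\<epsilon>} (\<lambda>\<tau>. \<epsilon> / a powr (1 + 2 * s))"
      by (intro absolutely_integrable_on_const bounded_set_imp_lmeasurable) auto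
    fix x assume x: "x \<in> {a..<\<epsilon>}"
    \<comment> \<open>Since s < 1, raising a number in (0, 1) to the power s increases it. So the
      numerator of \<open>b\<close> is at most \<epsilon> on the mismatch, whose length is
      \<open>\<epsilon>^2 / (1 + \<epsilon>)\<close>; this produces the positive power
      \<open>2 - 2 * s\<close> of \<epsilon>.\<close>
    have "1 - max 0 (1 - x) powr s \<le> x"
    proof (cases "x < 1")
      case True
      have "(1 - x) powr 1 \<le> (1 - x) powr s"
        using True x a s by (intro powr_mono') auto
      then show ?thesis using True x a by auto
    qed auto
    then show "b x \<le> \<epsilon> / a powr (1 + 2 * s)"
      unfolding b_def using x a s by (intro frac_le powr_mono2) auto
  qed
  also have "\<dots> = (\<epsilon> - a) * (\<epsilon> / a powr (1 + 2 * s))"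
    using a by (simp add: set_integral_const)
  also have "\<dots> = \<epsilon> powr (2 - 2 * s) * (1 + \<epsilon>) powr (2 * s)"
    using e by (simp add: a_def powr_divide powr_add powr_diff divide_simps power2_eq_square)
      (simp add: algebra_simps)
  finally show "(LINT \<tau>:{\<epsilon>..}|lebesgue. f \<tau>) \<le> \<epsilon> powr (2 - 2 * s) * (1 + \<epsilon>) powr (2 * s)" .
qed

text \<open>Homogeneity: with \<tau> = d\<sigma> the profile contributes degree s and the kernel
  with its measure degree -2s, which leaves the factor \<open>d powr (- s)\<close>. The evaluation
  point is now at depth \<open>d\<close> from the edge.\<close>

lemma half_line_truncated_scaled:
  fixes s d \<epsilon> :: real
  assumes s: "0 < s" "s < 1" and d: "0 < d" and e: "0 < \<epsilon>"
  defines "f \<equiv> \<lambda>\<tau>. ((d + \<tau>) powr s + max 0 (d - \<tau>) powr s - 2 * d powr s) / \<tau> powr (1 + 2 * s)"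
  shows "set_integrable lebesgue {d * \<epsilon>..} f"
    and "(LINT \<tau>:{d * \<epsilon>..}|lebesgue. f \<tau>)
      \<le> d powr (- s) * (\<epsilon> powr (2 - 2 * s) * (1 + \<epsilon>) powr (2 * s))"
proof -
  define f1 where "f1 = (\<lambda>\<tau>::real. ((1 + \<tau>) powr s + max 0 (1 - \<tau>) powr s - 2) / \<tau> powr (1 + 2 * s))"
  have f1: "set_integrable lebesgue {\<epsilon>..} f1"
    "(LINT \<tau>:{\<epsilon>..}|lebesgue. f1 \<tau>) \<le> \<epsilon> powr (2 - 2 * s) * (1 + \<epsilon>) powr (2 * s)"
    unfolding f1_def using half_line_truncated[OF s e] by auto
  have scale: "\<bar>d\<bar> * f (d * \<tau>) = d powr (- s) * f1 \<tau>" if "\<tau> \<in> {\<epsilon>..}" for \<tau>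
  proof -
    have "d + d * \<tau> = d * (1 + \<tau>)" "max 0 (d - d * \<tau>) = d * max 0 (1 - \<tau>)"
      using d by (auto simp: max_def algebra_simps mult_le_0_iff)
    moreover have "d powr (2 * s) = d powr s * d powr s" by (simp flip: powr_add)
    ultimately show ?thesis
      using d e that
      by (simp add: f_def f1_def powr_mult powr_add powr_minus divide_simps) (simp add: algebra_simps)
  qed
  have image: "(\<lambda>\<tau>. d * \<tau>) ` {\<epsilon>..} = {d * \<epsilon>..}"
  proof (intro equalityI subsetI)
    fix y assume "y \<in> {d * \<epsilon>..}"
    then have "y = d * (y / d)" "y / d \<in> {\<epsilon>..}" using d by (auto simp: field_simps)
    then show "y \<in> (\<lambda>\<tau>. d * \<tau>) ` {\<epsilon>..}" by blast
  qed (use d in auto)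
  have cov: "(\<lambda>\<tau>. \<bar>d\<bar> * f (d * \<tau>)) absolutely_integrable_on {\<epsilon>..} \<and>
           integral {\<epsilon>..} (\<lambda>\<tau>. \<bar>d\<bar> * f (d * \<tau>)) = c
     \<longleftrightarrow> f absolutely_integrable_on ((\<lambda>\<tau>. d * \<tau>) ` {\<epsilon>..}) \<and> integral ((\<lambda>\<tau>. d * \<tau>) ` {\<epsilon>..}) f = c" for c
    by (rule has_absolute_integral_change_of_variables_1')
      (use d in \<open>auto intro!: derivative_eq_intros simp: inj_on_def\<close>)
  have f1': "set_integrable lebesgue {\<epsilon>..} (\<lambda>\<tau>. d powr (- s) * f1 \<tau>)"
    using f1(1) by (rule set_integrable_mult_right)
  have "set_integrable lebesgue {\<epsilon>..} (\<lambda>\<tau>. \<bar>d\<bar> * f (d * \<tau>))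
      = set_integrable lebesgue {\<epsilon>..} (\<lambda>\<tau>. d powr (- s) * f1 \<tau>)"
    by (rule set_integrable_cong[OF refl refl scale])
  moreover have "integral {\<epsilon>..} (\<lambda>\<tau>. \<bar>d\<bar> * f (d * \<tau>)) = (LINT \<tau>:{\<epsilon>..}|lebesgue. d powr (- s) * f1 \<tau>)"
    unfolding set_lebesgue_integral_eq_integral(2)[OF f1']
    by (rule integral_cong) (use scale in auto)
  ultimately have f: "set_integrable lebesgue {d * \<epsilon>..} f"
    "integral {d * \<epsilon>..} f = d powr (- s) * (LINT \<tau>:{\<epsilon>..}|lebesgue. f1 \<tau>)"
    using cov[unfolded image, of "LINT \<tau>:{\<epsilon>..}|lebesgue. d powr (- s) * f1 \<tau>"] f1' by auto
  show "set_integrable lebesgue {d * \<epsilon>..} f" by fact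
  show "(LINT \<tau>:{d * \<epsilon>..}|lebesgue. f \<tau>)
      \<le> d powr (- s) * (\<epsilon> powr (2 - 2 * s) * (1 + \<epsilon>) powr (2 * s))"
    unfolding set_lebesgue_integral_eq_integral(2)[OF f(1)] f(2)
    using f1(2) by (intro mult_left_mono) auto
qed

section \<open>The gain from cutting the profile off\<close>

text \<open>\<open>g\<close> stands for a second difference at depth \<open>d\<close> inside a bump,
  compared with that of the half-line profile, whose integral contributes at most 0 in the limit. Up
  to \<open>2 * \<rho>\<close> the comparison only helps. Beyond it the profile keeps growing at
  least like \<open>\<tau> powr s\<close> while the bumps stay below \<open>\<rho> powr s\<close>,
  and integrating the difference gives a bound that no longer contains \<open>d\<close>.\<close>

lemma cap_integral_le:
  fixes s d \<rho> :: real and g :: "real \<Rightarrow> real"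
  assumes s: "0 < s" "s < 1" and d: "0 < d" "d \<le> \<rho>"
    and int: "set_integrable lebesgue {0<..} (\<lambda>\<tau>. g \<tau> / \<tau> powr (1 + 2 * s))"
    and near: "\<And>\<tau>. 0 < \<tau> \<Longrightarrow> \<tau> < 2 * \<rho> \<Longrightarrow>
      g \<tau> \<le> (d + \<tau>) powr s + max 0 (d - \<tau>) powr s - 2 * d powr s"
    and far: "\<And>\<tau>. 2 * \<rho> \<le> \<tau> \<Longrightarrow> g \<tau> \<le> 2 * \<rho> powr s - 2 * d powr s"
  shows "(LINT \<tau>:{0<..}|lebesgue. g \<tau> / \<tau> powr (1 + 2 * s))
    \<le> - (\<rho> powr (- s) * (2 powr (- s) - 2 powr (- 2 * s)) / s)"
proof -
  define f where "f = (\<lambda>\<tau>::real. ((d + \<tau>) powr s + max 0 (d - \<tau>) powr s - 2 * d powr s) / \<tau> powr (1 + 2 * s))"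
  define G where "G = (\<lambda>\<tau>. g \<tau> / \<tau> powr (1 + 2 * s))"
  \<comment> \<open>\<open>t\<close> majorizes the difference of the two integrands beyond
    \<open>2 * \<rho>\<close>. It is positive just after \<open>2 * \<rho>\<close>, because
    \<open>2 powr s < 2\<close>; only its integral \<open>T\<close> is negative.\<close>
  define t where "t = (\<lambda>\<tau>::real. 2 * \<rho> powr s * (1 / \<tau> powr (1 + 2 * s)) - 1 / \<tau> powr (1 + s))"
  define T where "T = - (\<rho> powr (- s) * (2 powr (- s) - 2 powr (- 2 * s)) / s)"
  have \<rho>: "0 < \<rho>" using d by simp
  have t_int: "set_integrable lebesgue {2 * \<rho>..} t"
    unfolding t_def using s \<rho>
    by (intro set_integral_diff set_integrable_mult_right powr_tail_integral) auto
  have "(LINT \<tau>:{2 * \<rho>..}|lebesgue. t \<tau>)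
      = 2 * \<rho> powr s * ((2 * \<rho>) powr (- 2 * s) / (2 * s)) - (2 * \<rho>) powr (- s) / s"
  proof -
    have 1: "1 < 1 + 2 * s" "1 < 1 + s" "0 < 2 * \<rho>" using s \<rho> by auto
    note p1 = powr_tail_integral[OF 1(1,3)] and p2 = powr_tail_integral[OF 1(2,3)]
    show ?thesis
      unfolding t_def set_integral_diff(2)[OF set_integrable_mult_right[OF p1(1)] p2(1)]
        set_integral_mult_right p1(2) p2(2) by simp
  qed
  also have "\<dots> = T"
  proof -
    have "\<rho> powr (- 2 * s) = \<rho> powr (- s) * \<rho> powr (- s)" by (simp flip: powr_add)
    then show ?thesis
      using \<rho> s unfolding T_def powr_mult
      by (simp add: powr_mult powr_minus field_simps)
  qed
  finally have t_val: "(LINT \<tau>:{2 * \<rho>..}|lebesgue. t \<tau>) = T" .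
  have bound: "(LINT \<tau>:{d * \<epsilon>..}|lebesgue. G \<tau>)
      \<le> T + d powr (- s) * (\<epsilon> powr (2 - 2 * s) * (1 + \<epsilon>) powr (2 * s))"
    if e: "0 < \<epsilon>" "\<epsilon> \<le> 1" for \<epsilon>
  proof -
    define c where "c = d * \<epsilon>"
    have c: "0 < c" "c < 2 * \<rho>"
      using d e mult_left_le[of \<epsilon> d] by (auto simp: c_def intro: mult_pos_pos le_less_trans[of _ d])
    have f_int: "set_integrable lebesgue {c..} f"
      and f_val: "(LINT \<tau>:{c..}|lebesgue. f \<tau>) \<le> d powr (- s) * (\<epsilon> powr (2 - 2 * s) * (1 + \<epsilon>) powr (2 * s))"
      unfolding f_def c_def using half_line_truncated_scaled[OF s d(1) e(1)] by auto
    have G_int: "set_integrable lebesgue {c..} G"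
      unfolding G_def using int by (rule set_integrable_subset) (use c in auto)
    have D_int: "set_integrable lebesgue S (\<lambda>\<tau>. G \<tau> - f \<tau>)" if "S \<in> sets lebesgue" "S \<subseteq> {c..}" for S
      using set_integrable_subset[OF set_integral_diff(1)[OF G_int f_int]] that by blast
    have "(LINT \<tau>:{c..}|lebesgue. G \<tau>) - (LINT \<tau>:{c..}|lebesgue. f \<tau>)
        = (LINT \<tau>:{c..}|lebesgue. G \<tau> - f \<tau>)"
      using set_integral_diff(2)[OF G_int f_int] by simp
    also have "\<dots> = (LINT \<tau>:{c..<2 * \<rho>}|lebesgue. G \<tau> - f \<tau>) + (LINT \<tau>:{2 * \<rho>..}|lebesgue. G \<tau> - f \<tau>)"
    proof -
      have "{c..} = {c..<2 * \<rho>} \<union> {2 * \<rho>..}" using c by auto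
      then show ?thesis using c by (auto intro!: set_integral_Un D_int)
    qed
    also have "\<dots> \<le> 0 + T"
    proof (rule add_mono)
      have "(LINT \<tau>:{c..<2 * \<rho>}|lebesgue. G \<tau> - f \<tau>) \<le> (LINT \<tau>:{c..<2 * \<rho>}|lebesgue. 0)"
      proof (rule set_integral_mono)
        show "set_integrable lebesgue {c..<2 * \<rho>} (\<lambda>\<tau>. G \<tau> - f \<tau>)" by (rule D_int) auto
        show "set_integrable lebesgue {c..<2 * \<rho>} (\<lambda>\<tau>. 0 :: real)" by (simp add: set_integrable_def)
        fix x assume "x \<in> {c..<2 * \<rho>}"
        then show "G x - f x \<le> 0"
          unfolding G_def f_def using c near[of x] by (simp add: divide_right_mono)
      qed
      then show "(LINT \<tau>:{c..<2 * \<rho>}|lebesgue. G \<tau> - f \<tau>) \<le> 0" by simp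
      have "(LINT \<tau>:{2 * \<rho>..}|lebesgue. G \<tau> - f \<tau>) \<le> (LINT \<tau>:{2 * \<rho>..}|lebesgue. t \<tau>)"
      proof (rule set_integral_mono)
        show "set_integrable lebesgue {2 * \<rho>..} (\<lambda>\<tau>. G \<tau> - f \<tau>)" using c by (intro D_int) auto
        fix x assume x: "x \<in> {2 * \<rho>..}"
        have "x powr s \<le> (d + x) powr s" using x d \<rho> s by (intro powr_mono2) auto
        moreover have "0 \<le> max 0 (d - x) powr s" by simp
        moreover have "g x \<le> 2 * \<rho> powr s - 2 * d powr s" using far x by simp
        ultimately have "g x - ((d + x) powr s + max 0 (d - x) powr s - 2 * d powr s) \<le> 2 * \<rho> powr s - x powr s"
          by linarith
        then have "G x - f x \<le> (2 * \<rho> powr s - x powr s) / x powr (1 + 2 * s)"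
          unfolding G_def f_def diff_divide_distrib[symmetric] by (intro divide_right_mono) auto
        also have "\<dots> = t x"
        proof -
          have "x powr (1 + 2 * s) = x powr s * x powr (1 + s)"
            by (simp add: algebra_simps flip: powr_add)
          then show ?thesis using x \<rho> by (simp add: t_def diff_divide_distrib)
        qed
        finally show "G x - f x \<le> t x" .
      qed (rule t_int)
      then show "(LINT \<tau>:{2 * \<rho>..}|lebesgue. G \<tau> - f \<tau>) \<le> T" using t_val by simp
    qed
    finally show ?thesis using f_val by (simp add: c_def)
  qed
  \<comment> \<open>The profile is controlled only through truncated integrals, so the truncation is
    removed for \<open>G\<close> alone: \<open>G\<close> is integrable on \<open>{0<..}\<close> and
    the defect vanishes as \<open>e n\<close> tends to 0.\<close>
  define e where "e = (\<lambda>n. inverse (real (Suc n)))"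
  have e: "0 < e n" "e n \<le> 1" for n by (auto simp: e_def field_simps)
  have e0: "e \<longlonglongrightarrow> 0" unfolding e_def by (rule LIMSEQ_inverse_real_of_nat)
  have U: "(\<Union>n. {d * e n..}) = {0<..}"
  proof (intro equalityI subsetI)
    fix x assume "x \<in> (\<Union>n. {d * e n..})"
    then show "x \<in> {0<..}" using d e(1) by (auto intro: less_le_trans[OF mult_pos_pos])
  next
    fix x :: real assume "x \<in> {0<..}"
    then have "0 < x / d" using d by simp
    then obtain n where "e n < x / d" unfolding e_def using reals_Archimedean by blast
    then show "x \<in> (\<Union>n. {d * e n..})" using d by (auto simp: field_simps intro!: exI[of _ n])
  qed
  have lim: "(\<lambda>n. LINT \<tau>:{d * e n..}|lebesgue. G \<tau>) \<longlonglongrightarrow> (LINT \<tau>:(\<Union>n. {d * e n..})|lebesgue. G \<tau>)"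
  proof (rule set_integral_cont_up)
    show "incseq (\<lambda>n. {d * e n..})"
      using d by (auto simp: incseq_def e_def intro!: mult_left_mono le_imp_inverse_le)
    show "set_integrable lebesgue (\<Union>n. {d * e n..}) G" unfolding U G_def by (rule int)
  qed auto
  have "(\<lambda>n. T + d powr (- s) * (e n powr (2 - 2 * s) * (1 + e n) powr (2 * s)))
      \<longlonglongrightarrow> T + d powr (- s) * (0 * (1 + 0) powr (2 * s))"
    using s e by (intro tendsto_intros tendsto_zero_powrI[OF e0 tendsto_const] e0) (auto simp: less_imp_le)
  then have "(LINT \<tau>:{0<..}|lebesgue. G \<tau>) \<le> T + d powr (- s) * (0 * (1 + 0) powr (2 * s))"
    using lim[unfolded U] bound[OF e] by (intro LIMSEQ_le) auto
  then show ?thesis by (simp add: G_def T_def)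
qed

section \<open>Test functions and bounds for the directional operators\<close>

text \<open>The derivative of the symmetric sum in t is a difference of two gradients at distance t
  from \<open>x\<close>. Differentiability of \<open>D\<close> at \<open>x\<close> makes each
  gradient differ from \<open>D x\<close> by at most a multiple of t, and the mean value theorem
  supplies the second factor \<tau>. The constants serve all directions at once.\<close>

lemma C2_second_difference:
  fixes \<phi> :: "'a::euclidean_space \<Rightarrow> real"
  assumes "C2_closure (ball x r) \<phi>" "0 < r"
  obtains K \<delta> where "0 < \<delta>" "\<delta> < r"
    "\<And>\<xi> \<tau>. norm \<xi> = 1 \<Longrightarrow> 0 < \<tau> \<Longrightarrow> \<tau> \<le> \<delta> \<Longrightarrow>
      \<bar>\<phi> (x + \<tau> *\<^sub>R \<xi>) + \<phi> (x - \<tau> *\<^sub>R \<xi>) - 2 * \<phi> x\<bar> \<le> K * \<tau>\<^sup>2"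
proof -
  obtain D H where D: "\<And>y. y \<in> ball x r \<Longrightarrow> (\<phi> has_derivative blinfun_apply (D y)) (at y)"
    and H: "(D has_derivative blinfun_apply (H x)) (at x)"
    using assms unfolding C2_closure_def C2_derivs_def by (metis centre_in_ball)
  obtain d where d: "0 < d"
    "\<And>y. norm (y - x) < d \<Longrightarrow> norm (D y - D x - blinfun_apply (H x) (y - x)) \<le> 1 * norm (y - x)"
    using H[unfolded has_derivative_at_alt] by (metis zero_less_one)
  define K where "K = norm (H x) + 1"
  have D_lip: "norm (D y - D x) \<le> K * norm (y - x)" if "norm (y - x) < d" for y
  proof -
    have "norm (D y - D x) \<le> norm (D y - D x - blinfun_apply (H x) (y - x)) + norm (blinfun_apply (H x) (y - x))"
      by (metis diff_add_cancel norm_triangle_ineq)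
    also have "\<dots> \<le> 1 * norm (y - x) + norm (H x) * norm (y - x)"
      by (intro add_mono d(2) that norm_blinfun)
    finally show ?thesis by (simp add: K_def algebra_simps)
  qed
  define \<delta> where "\<delta> = min d r / 2"
  show ?thesis
  proof
    show "0 < \<delta>" "\<delta> < r" using d assms by (auto simp: K_def \<delta>_def)
    fix \<xi> :: 'a and \<tau> :: real
    assume \<xi>: "norm \<xi> = 1" and \<tau>: "0 < \<tau>" "\<tau> \<le> \<delta>"
    define f where "f = (\<lambda>t. \<phi> (x + t *\<^sub>R \<xi>) + \<phi> (x - t *\<^sub>R \<xi>))"
    define f' where "f' = (\<lambda>t. D (x + t *\<^sub>R \<xi>) \<xi> - D (x - t *\<^sub>R \<xi>) \<xi>)"
    have "(f has_real_derivative f' t) (at t)" if t: "0 \<le> t" "t \<le> \<tau>" for t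
    proof -
      have "x + t *\<^sub>R \<xi> \<in> ball x r" "x - t *\<^sub>R \<xi> \<in> ball x r"
        using t \<tau> \<xi> d assms by (auto simp: dist_norm \<delta>_def)
      note D' = D[OF this(1)] D[OF this(2)]
      have "((\<lambda>t. \<phi> (x + t *\<^sub>R \<xi>)) has_derivative (\<lambda>h. D (x + t *\<^sub>R \<xi>) (h *\<^sub>R \<xi>))) (at t)"
        by (rule has_derivative_compose[where f="\<lambda>t. x + t *\<^sub>R \<xi>" and g=\<phi>, OF _ D'(1)]) (auto intro!: derivative_eq_intros)
      moreover have "((\<lambda>t. \<phi> (x - t *\<^sub>R \<xi>)) has_derivative (\<lambda>h. D (x - t *\<^sub>R \<xi>) (- (h *\<^sub>R \<xi>)))) (at t)"
        by (rule has_derivative_compose[where f="\<lambda>t. x - t *\<^sub>R \<xi>" and g=\<phi>, OF _ D'(2)]) (auto intro!: derivative_eq_intros)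
      ultimately have "(f has_derivative (\<lambda>h. D (x + t *\<^sub>R \<xi>) (h *\<^sub>R \<xi>) + D (x - t *\<^sub>R \<xi>) (- (h *\<^sub>R \<xi>)))) (at t)"
        unfolding f_def by (rule has_derivative_add)
      moreover have "(\<lambda>h. D (x + t *\<^sub>R \<xi>) (h *\<^sub>R \<xi>) + D (x - t *\<^sub>R \<xi>) (- (h *\<^sub>R \<xi>))) = (*) (f' t)"
        by (rule ext) (simp add: f'_def blinfun.scaleR_right blinfun.minus_right algebra_simps)
      ultimately show ?thesis by (simp add: has_field_derivative_def)
    qed
    then obtain z where z: "0 < z" "z < \<tau>" "f \<tau> - f 0 = (\<tau> - 0) * f' z"
      using MVT2[of 0 \<tau> f f'] \<tau> by blast
    have z': "norm ((x + z *\<^sub>R \<xi>) - x) < d" "norm ((x - z *\<^sub>R \<xi>) - x) < d"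
      using z \<tau> \<xi> d assms by (auto simp: \<delta>_def)
    have "\<bar>f' z\<bar> = norm ((D (x + z *\<^sub>R \<xi>) - D (x - z *\<^sub>R \<xi>)) \<xi>)"
      by (simp add: f'_def blinfun.diff_left)
    also have "\<dots> \<le> norm (D (x + z *\<^sub>R \<xi>) - D (x - z *\<^sub>R \<xi>))"
      using norm_blinfun[of "D (x + z *\<^sub>R \<xi>) - D (x - z *\<^sub>R \<xi>)" \<xi>] \<xi> by simp
    also have "\<dots> \<le> norm (D (x + z *\<^sub>R \<xi>) - D x) + norm (D (x - z *\<^sub>R \<xi>) - D x)"
      using norm_triangle_ineq4[of "D (x + z *\<^sub>R \<xi>) - D x" "D (x - z *\<^sub>R \<xi>) - D x"] by simp
    also have "\<dots> \<le> K * z + K * z"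
      using D_lip[OF z'(1)] D_lip[OF z'(2)] \<xi> z by (intro add_mono) auto
    also have "\<dots> \<le> 2 * K * \<tau>"
    proof -
      have "K * z \<le> K * \<tau>" using z by (intro mult_left_mono) (auto simp: K_def)
      then show ?thesis by simp
    qed
    finally have "\<bar>f' z\<bar> \<le> 2 * K * \<tau>" .
    then have "\<tau> * \<bar>f' z\<bar> \<le> \<tau> * (2 * K * \<tau>)" using \<tau> by (intro mult_left_mono) auto
    moreover have "\<phi> (x + \<tau> *\<^sub>R \<xi>) + \<phi> (x - \<tau> *\<^sub>R \<xi>) - 2 * \<phi> x = \<tau> * f' z"
      using z by (simp add: f_def)
    ultimately show "\<bar>\<phi> (x + \<tau> *\<^sub>R \<xi>) + \<phi> (x - \<tau> *\<^sub>R \<xi>) - 2 * \<phi> x\<bar> \<le> 2 * K * \<tau>\<^sup>2"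
      using \<tau> by (simp add: abs_mult power2_eq_square algebra_simps)
  qed
qed

text \<open>The common dominator of all directional integrands. Near 0 it is a multiple of
  \<open>\<tau> powr (1 - 2 * s)\<close>, integrable since s < 1; the tail converges since 0 <
  s.\<close>

lemma Levy_bound_integrable:
  fixes s \<delta> K L :: real
  assumes "0 < s" "s < 1" "0 < \<delta>"
  shows "set_integrable lebesgue {0<..} (\<lambda>\<tau>. (if \<tau> \<le> \<delta> then K * \<tau>\<^sup>2 else L) / \<tau> powr (1 + 2 * s))"
    (is "set_integrable _ _ ?B")
proof -
  have "(\<lambda>\<tau>. \<tau> powr (1 - 2 * s)) absolutely_integrable_on {0..\<delta>}"
    by (rule nonnegative_absolutely_integrable_1)
      (use has_integral_powr_from_0[of "1 - 2 * s" \<delta>] assms in auto)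
  then have "(\<lambda>\<tau>. \<tau> powr (1 - 2 * s)) absolutely_integrable_on {0<..\<delta>}"
    by (rule set_integrable_subset) auto
  then have "(\<lambda>\<tau>. K * \<tau> powr (1 - 2 * s)) absolutely_integrable_on {0<..\<delta>}"
    by (rule set_integrable_mult_right)
  also have "?this \<longleftrightarrow> ?B absolutely_integrable_on {0<..\<delta>}"
  proof (rule set_integrable_cong)
    fix x assume x: "x \<in> {0<..\<delta>}"
    have "x powr 2 = x powr (1 - 2 * s) * x powr (1 + 2 * s)" by (simp flip: powr_add)
    then show "K * x powr (1 - 2 * s) = ?B x" using x by simp
  qed auto
  finally have 1: "?B absolutely_integrable_on {0<..\<delta>}" .
  have "(\<lambda>\<tau>. 1 / \<tau> powr (1 + 2 * s)) absolutely_integrable_on {\<delta><..}"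
    by (rule set_integrable_subset[OF powr_tail_integral(1)[of _ \<delta>]]) (use assms in auto)
  then have "(\<lambda>\<tau>. L * (1 / \<tau> powr (1 + 2 * s))) absolutely_integrable_on {\<delta><..}"
    by (rule set_integrable_mult_right)
  also have "?this \<longleftrightarrow> ?B absolutely_integrable_on {\<delta><..}"
    by (rule set_integrable_cong) auto
  finally have 2: "?B absolutely_integrable_on {\<delta><..}" .
  have "{0<..} = {0<..\<delta>} \<union> {\<delta><..}" using assms by auto
  with set_integrable_Un[OF 1 2] show ?thesis by simp
qed

text \<open>If \<open>G\<close> is not integrable, its integral is 0 by convention, and the bound
  persists because the dominator is nonnegative.\<close>

lemma set_integral_ge_minus_dominator:
  fixes G B :: "'a \<Rightarrow> real"
  assumes B: "set_integrable M S B" and GB: "\<And>x. x \<in> S \<Longrightarrow> \<bar>G x\<bar> \<le> B x"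
  shows "- (LINT x:S|M. B x) \<le> (LINT x:S|M. G x)"
proof (cases "set_integrable M S G")
  case True
  have "(LINT x:S|M. - B x) \<le> (LINT x:S|M. G x)"
  proof (rule set_integral_mono)
    show "set_integrable M S (\<lambda>x. - B x)"
      using B by (simp add: set_integrable_def)
    show "- B x \<le> G x" if "x \<in> S" for x using GB[OF that] by simp
  qed (rule True)
  then show ?thesis by (simp add: set_lebesgue_integral_def)
next
  case False
  then have "(LINT x:S|M. G x) = 0"
    by (simp add: set_lebesgue_integral_def set_integrable_def not_integrable_integral_eq)
  moreover have "0 \<le> (LINT x:S|M. B x)"
    using GB unfolding set_lebesgue_integral_def
    by (intro Bochner_Integration.integral_nonneg) (auto simp: indicator_def intro: order_trans[OF abs_ge_zero])
  ultimately show ?thesis by simp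
qed

text \<open>The integrand is nonpositive; the default value 0 of a divergent integral is compatible
  with the conclusion.\<close>

lemma dir_op_nonpos:
  assumes "0 \<le> c" "\<And>\<tau>. 0 < \<tau> \<Longrightarrow> v (x + \<tau> *\<^sub>R \<xi>) + v (x - \<tau> *\<^sub>R \<xi>) \<le> 2 * v x"
  shows "dir_op c s \<xi> v x \<le> 0"
proof -
  have "0 \<le> (LINT \<tau>|lebesgue. - (indicator {0<..} \<tau> *\<^sub>R
      ((v (x + \<tau> *\<^sub>R \<xi>) + v (x - \<tau> *\<^sub>R \<xi>) - 2 * v x) / \<tau> powr (1 + 2 * s))))"
    using assms(2) by (intro Bochner_Integration.integral_nonneg) (auto simp: indicator_def divide_nonpos_nonneg)
  then show ?thesis
    using assms(1) unfolding dir_op_def set_lebesgue_integral_def by (simp add: mult_nonneg_nonpos)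
qed

lemma Basis_subset_orthonormal:
  fixes B :: "'a::euclidean_space set"
  assumes "B \<subseteq> Basis"
  shows "B \<in> orthonormal_families (card B)"
  using assms finite_subset[OF assms]
  by (auto simp: orthonormal_families_def pairwise_def orthogonal_def inner_not_same_Basis subset_iff)

text \<open>A real infimum lies below its members only if the set is bounded below. The dominator is
  the same for every unit vector, so every k-element family has sum at least
  \<open>- k * c * b\<close>.\<close>

lemma inf_op_le:
  fixes v :: "'a::euclidean_space \<Rightarrow> real"
  assumes s: "0 < s" "s < 1" and c: "0 \<le> c" and \<delta>: "0 < \<delta>"
    and near: "\<And>\<xi> \<tau>. norm \<xi> = 1 \<Longrightarrow> 0 < \<tau> \<Longrightarrow> \<tau> \<le> \<delta> \<Longrightarrow>
      \<bar>v (x + \<tau> *\<^sub>R \<xi>) + v (x - \<tau> *\<^sub>R \<xi>) - 2 * v x\<bar> \<le> K * \<tau>\<^sup>2"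
    and bounded: "\<And>y. \<bar>v y\<bar> \<le> M"
    and B: "B \<in> orthonormal_families k"
  shows "inf_op c s k v x \<le> (\<Sum>\<xi>\<in>B. dir_op c s \<xi> v x)"
proof -
  define b where "b = (LINT \<tau>:{0<..}|lebesgue. (if \<tau> \<le> \<delta> then K * \<tau>\<^sup>2 else 4 * M) / \<tau> powr (1 + 2 * s))"
  have dir: "- (c * b) \<le> dir_op c s \<xi> v x" if \<xi>: "norm \<xi> = 1" for \<xi>
  proof -
    have "- b \<le> (LINT \<tau>:{0<..}|lebesgue.
        (v (x + \<tau> *\<^sub>R \<xi>) + v (x - \<tau> *\<^sub>R \<xi>) - 2 * v x) / \<tau> powr (1 + 2 * s))"
      unfolding b_def
    proof (rule set_integral_ge_minus_dominator[OF Levy_bound_integrable[OF s \<delta>]])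
      fix \<tau> :: real assume "\<tau> \<in> {0<..}"
      moreover have "\<bar>v (x + \<tau> *\<^sub>R \<xi>) + v (x - \<tau> *\<^sub>R \<xi>) - 2 * v x\<bar> \<le> 4 * M"
        using bounded[of "x + \<tau> *\<^sub>R \<xi>"] bounded[of "x - \<tau> *\<^sub>R \<xi>"] bounded[of x] by linarith
      ultimately show "\<bar>(v (x + \<tau> *\<^sub>R \<xi>) + v (x - \<tau> *\<^sub>R \<xi>) - 2 * v x) / \<tau> powr (1 + 2 * s)\<bar>
          \<le> (if \<tau> \<le> \<delta> then K * \<tau>\<^sup>2 else 4 * M) / \<tau> powr (1 + 2 * s)"
        using near[OF \<xi>, of \<tau>] by (auto simp: abs_divide intro!: divide_right_mono)
    qed
    then show ?thesis
      using c mult_left_mono[of "- b"] by (fastforce simp: dir_op_def)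
  qed
  have "bdd_below ((\<lambda>B. \<Sum>\<xi>\<in>B. dir_op c s \<xi> v x) ` orthonormal_families k)"
  proof (rule bdd_belowI2)
    fix B :: "'a set" assume "B \<in> orthonormal_families k"
    then have "card B = k" "\<And>\<xi>. \<xi> \<in> B \<Longrightarrow> norm \<xi> = 1" by (auto simp: orthonormal_families_def)
    then show "real k * - (c * b) \<le> (\<Sum>\<xi>\<in>B. dir_op c s \<xi> v x)"
      using sum_bounded_below[of B "- (c * b)" "\<lambda>\<xi>. dir_op c s \<xi> v x"] dir by auto
  qed
  then show ?thesis unfolding inf_op_def using B by (rule cINF_lower)
qed

section \<open>The comb profile\<close>

text \<open>Subadditivity of the power s: write \<open>(x + y) powr s\<close> as
  \<open>(x + y) * (x + y) powr (s - 1)\<close> and use that the power with negative exponent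
  \<open>s - 1\<close> decreases.\<close>

lemma abs_powr_diff_le:
  fixes a b s :: real
  assumes "0 \<le> a" "0 \<le> b" "0 < s" "s < 1"
  shows "\<bar>a powr s - b powr s\<bar> \<le> \<bar>a - b\<bar> powr s"
proof -
  have *: "(x + y) powr s \<le> x powr s + y powr s" if "0 \<le> x" "0 \<le> y" for x y :: real
  proof (cases "x = 0 \<or> y = 0")
    case False
    then have xy: "0 < x" "0 < y" using that by auto
    have "(x + y) powr s = (x + y) * (x + y) powr (s - 1)"
      using xy by (simp add: powr_diff)
    also have "\<dots> = x * (x + y) powr (s - 1) + y * (x + y) powr (s - 1)"
      by (rule distrib_right)
    also have "\<dots> \<le> x * x powr (s - 1) + y * y powr (s - 1)"
      using xy assms by (intro add_mono mult_left_mono powr_mono2') auto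
    finally show ?thesis using xy by (simp add: powr_diff)
  qed auto
  show ?thesis
  proof (cases "a \<le> b")
    case True
    then have "a powr s \<le> b powr s" using assms by (intro powr_mono2) auto
    then show ?thesis using *[of a "b - a"] True assms by simp
  next
    case False
    then have "b powr s \<le> a powr s" using assms by (intro powr_mono2) auto
    then show ?thesis using *[of b "a - b"] False assms by simp
  qed
qed

text \<open>\<open>Suc n\<close> puts the first centre at \<open>4 * \<rho>\<close>, so all bumps
  lie in t > 0. The spacing \<open>4 * \<rho>\<close> ensures that a walk of length below
  \<open>2 * \<rho>\<close> from inside one bump towards its nearer edge meets no other
  bump.\<close>

definition comb_centres :: "real \<Rightarrow> real set" where
  "comb_centres \<rho> = range (\<lambda>n. 4 * \<rho> * real (Suc n))"

text \<open>The row of bumps, written through the distance to the centres: this distance is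
  1-Lipschitz, so the Hoelder bound is inherited from the power s.\<close>

definition comb :: "real \<Rightarrow> real \<Rightarrow> real \<Rightarrow> real" where
  "comb s \<rho> t = max 0 (\<rho> - infdist t (comb_centres \<rho>)) powr s"

lemma comb_centres_nonempty: "comb_centres \<rho> \<noteq> {}"
  by (simp add: comb_centres_def)

lemma infdist_ge:
  assumes "A \<noteq> {}" "\<And>a. a \<in> A \<Longrightarrow> r \<le> dist x a"
  shows "r \<le> infdist x A"
  using assms by (auto simp: infdist_notempty intro: cINF_greatest)

lemma comb_centres_separated:
  assumes "a \<in> comb_centres \<rho>" "b \<in> comb_centres \<rho>" "a \<noteq> b" "0 < \<rho>"
  shows "4 * \<rho> \<le> \<bar>a - b\<bar>"
proof -
  obtain m n where mn: "a = 4 * \<rho> * real (Suc m)" "b = 4 * \<rho> * real (Suc n)"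
    using assms by (auto simp: comb_centres_def)
  then have "1 \<le> \<bar>int m - int n\<bar>" using assms by auto
  then have "1 \<le> \<bar>real m - real n\<bar>" by linarith
  then have "4 * \<rho> * 1 \<le> 4 * \<rho> * \<bar>real m - real n\<bar>" using assms by (intro mult_left_mono) auto
  also have "4 * \<rho> * \<bar>real m - real n\<bar> = \<bar>4 * \<rho> * (real m - real n)\<bar>"
    using assms by (simp add: abs_mult)
  also have "4 * \<rho> * (real m - real n) = a - b" by (simp add: mn algebra_simps)
  finally show ?thesis by simp
qed

lemma comb_nonneg: "0 \<le> comb s \<rho> t"
  by (simp add: comb_def)

lemma comb_le: "0 < s \<Longrightarrow> 0 < \<rho> \<Longrightarrow> comb s \<rho> t \<le> \<rho> powr s"
  unfolding comb_def by (intro powr_mono2) (auto simp: infdist_nonneg)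

lemma comb_holder:
  assumes "0 < s" "s < 1"
  shows "\<bar>comb s \<rho> t - comb s \<rho> t'\<bar> \<le> \<bar>t - t'\<bar> powr s"
proof -
  have "\<bar>comb s \<rho> t - comb s \<rho> t'\<bar>
      \<le> \<bar>max 0 (\<rho> - infdist t (comb_centres \<rho>)) - max 0 (\<rho> - infdist t' (comb_centres \<rho>))\<bar> powr s"
    unfolding comb_def using assms by (intro abs_powr_diff_le) auto
  also have "\<dots> \<le> \<bar>t - t'\<bar> powr s"
    using assms infdist_triangle_abs[of t "comb_centres \<rho>" t']
    by (intro powr_mono2) (auto simp: dist_real_def)
  finally show ?thesis .
qed

lemma continuous_on_comb [continuous_intros]:
  "0 < s \<Longrightarrow> continuous_on S f \<Longrightarrow> continuous_on S (\<lambda>x. comb s \<rho> (f x))"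
  unfolding comb_def by (intro continuous_intros continuous_on_powr') auto

lemma comb_nonpos: "0 < \<rho> \<Longrightarrow> t \<le> 0 \<Longrightarrow> comb s \<rho> t = 0"
proof -
  assume \<rho>: "0 < \<rho>" and t: "t \<le> 0"
  have "\<rho> \<le> infdist t (comb_centres \<rho>)"
  proof (rule infdist_ge[OF comb_centres_nonempty])
    fix a assume "a \<in> comb_centres \<rho>"
    then obtain n where "a = 4 * \<rho> * real (Suc n)" by (auto simp: comb_centres_def)
    moreover have "\<rho> * 1 \<le> \<rho> * (4 * real (Suc n))" using \<rho> by (intro mult_left_mono) auto
    ultimately have "\<rho> \<le> a" by (simp add: algebra_simps)
    then show "\<rho> \<le> dist t a" using t by (simp add: dist_real_def)
  qed
  then show ?thesis by (simp add: comb_def)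
qed

lemma comb_centre: "0 < \<rho> \<Longrightarrow> a \<in> comb_centres \<rho> \<Longrightarrow> comb s \<rho> a = \<rho> powr s"
  by (simp add: comb_def)

text \<open>\<open>q\<close> points from the centre of the bump through \<open>t\<close> to its
  nearer edge and \<open>d\<close> is the distance to that edge. Outward the other bumps are too far
  away to matter; inward the bound holds for every \<tau>, since the distance to the centres falls
  by at most \<tau>.\<close>

lemma comb_positive_point:
  assumes s: "0 < s" and \<rho>: "0 < \<rho>" and pos: "0 < comb s \<rho> t"
  obtains d q where "0 < d" "d \<le> \<rho>" "q = 1 \<or> q = -1" "comb s \<rho> t = d powr s"
    "\<And>\<tau>. 0 < \<tau> \<Longrightarrow> \<tau> < 2 * \<rho> \<Longrightarrow> comb s \<rho> (t + q * \<tau>) \<le> max 0 (d - \<tau>) powr s"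
    "\<And>\<tau>. 0 < \<tau> \<Longrightarrow> comb s \<rho> (t - q * \<tau>) \<le> (d + \<tau>) powr s"
proof -
  let ?A = "comb_centres \<rho>"
  have "infdist t ?A < \<rho>"
  proof (rule ccontr)
    assume "\<not> ?thesis"
    then show False using pos by (simp add: comb_def)
  qed
  then obtain a where a: "a \<in> ?A" "\<bar>t - a\<bar> < \<rho>"
    using infdist_ge[OF comb_centres_nonempty, of \<rho> \<rho> t] by (force simp: dist_real_def)
  define q :: real where "q = (if a \<le> t then 1 else -1)"
  define d where "d = \<rho> - \<bar>t - a\<bar>"
  have far: "4 * \<rho> - \<bar>y - a\<bar> \<le> \<bar>y - b\<bar>" if "b \<in> ?A" "b \<noteq> a" for b y
    using comb_centres_separated[OF that(1) a(1) that(2) \<rho>] by linarith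
  have inf_t: "infdist t ?A = \<bar>t - a\<bar>"
  proof (rule antisym)
    show "infdist t ?A \<le> \<bar>t - a\<bar>" using infdist_le[OF a(1), of t] by (simp add: dist_real_def)
    show "\<bar>t - a\<bar> \<le> infdist t ?A"
    proof (rule infdist_ge[OF comb_centres_nonempty])
      fix b assume "b \<in> ?A"
      then show "\<bar>t - a\<bar> \<le> dist t b"
        using far[of b t] a \<rho> by (cases "b = a") (auto simp: dist_real_def)
    qed
  qed
  show ?thesis
  proof
    show "0 < d" "d \<le> \<rho>" "q = 1 \<or> q = -1" using a by (auto simp: d_def q_def)
    show "comb s \<rho> t = d powr s" using \<open>0 < d\<close> by (simp add: comb_def inf_t d_def)
  next
    fix \<tau> :: real assume \<tau>: "0 < \<tau>" "\<tau> < 2 * \<rho>"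
    have q: "\<bar>t + q * \<tau> - a\<bar> = \<bar>t - a\<bar> + \<tau>" using \<tau> by (auto simp: q_def)
    \<comment> \<open>The point is less than \<open>3 * \<rho>\<close> from \<open>a\<close>, hence
      more than \<rho> from every other centre, where the comb is cut to 0 anyway.\<close>
    have "min \<rho> (\<bar>t - a\<bar> + \<tau>) \<le> infdist (t + q * \<tau>) ?A"
    proof (rule infdist_ge[OF comb_centres_nonempty])
      fix b assume "b \<in> ?A"
      then show "min \<rho> (\<bar>t - a\<bar> + \<tau>) \<le> dist (t + q * \<tau>) b"
        using far[of b "t + q * \<tau>"] a \<tau> q by (cases "b = a") (auto simp: dist_real_def)
    qed
    then show "comb s \<rho> (t + q * \<tau>) \<le> max 0 (d - \<tau>) powr s"
      unfolding comb_def d_def using s by (intro powr_mono2) auto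
  next
    fix \<tau> :: real assume \<tau>: "0 < \<tau>"
    have "infdist t ?A \<le> infdist (t - q * \<tau>) ?A + \<tau>"
      using infdist_triangle[of t ?A "t - q * \<tau>"] \<tau> by (auto simp: dist_real_def q_def split: if_splits)
    then show "comb s \<rho> (t - q * \<tau>) \<le> (d + \<tau>) powr s"
      unfolding comb_def d_def inf_t using s \<tau> a by (intro powr_mono2) auto
  qed
qed

section \<open>The viscosity inequality\<close>

lemma horizontal_frame:
  assumes "k \<le> DIM('a::euclidean_space)"
  obtains B where "B \<subseteq> (\<lambda>b::'a. (b, 0::real)) ` Basis" "card B = k"
proof -
  have "card ((\<lambda>b::'a. (b, 0::real)) ` Basis) = DIM('a)"
    by (rule card_image) (auto simp: inj_on_def)
  with assms have "k \<le> card ((\<lambda>b::'a. (b, 0::real)) ` Basis)" by simp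
  then show ?thesis by (rule obtain_subset_with_card_n) (rule that)
qed

text \<open>\<open>v\<close> is the glued test function. Lying below the comb and touching it at
  \<open>x\<close>, it has the smaller second difference there, so the estimate for the capped
  profile applies to it.\<close>

lemma comb_dir_op_le:
  fixes v :: "'a::euclidean_space \<times> real \<Rightarrow> real"
  assumes s: "0 < s" "s < 1" and c: "0 \<le> c" and \<rho>: "0 < \<rho>" and \<delta>: "0 < \<delta>"
    and meas: "v \<in> borel_measurable borel"
    and near: "\<And>\<tau>. 0 < \<tau> \<Longrightarrow> \<tau> \<le> \<delta> \<Longrightarrow>
      \<bar>v (x + \<tau> *\<^sub>R (0, 1)) + v (x - \<tau> *\<^sub>R (0, 1)) - 2 * v x\<bar> \<le> K * \<tau>\<^sup>2"
    and bounded: "\<And>y. \<bar>v y\<bar> \<le> M"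
    and le: "\<And>y. v y \<le> comb s \<rho> (snd y)" and eq: "v x = comb s \<rho> (snd x)"
    and pos: "0 < v x"
  shows "dir_op c s (0, 1) v x \<le> - (c * (\<rho> powr (- s) * (2 powr (- s) - 2 powr (- 2 * s)) / s))"
proof -
  define g where "g = (\<lambda>\<tau>. v (x + \<tau> *\<^sub>R (0, 1)) + v (x - \<tau> *\<^sub>R (0, 1)) - 2 * v x)"
  obtain d q where d: "0 < d" "d \<le> \<rho>" and q: "q = 1 \<or> q = -1"
    and vd: "comb s \<rho> (snd x) = d powr s"
    and out: "\<And>\<tau>. 0 < \<tau> \<Longrightarrow> \<tau> < 2 * \<rho> \<Longrightarrow> comb s \<rho> (snd x + q * \<tau>) \<le> max 0 (d - \<tau>) powr s"
    and inw: "\<And>\<tau>. 0 < \<tau> \<Longrightarrow> comb s \<rho> (snd x - q * \<tau>) \<le> (d + \<tau>) powr s"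
    by (rule comb_positive_point[OF s(1) \<rho> pos[unfolded eq]]) (rule that; simp)
  have g_le: "g \<tau> \<le> comb s \<rho> (snd x + q * \<tau>) + comb s \<rho> (snd x - q * \<tau>) - 2 * d powr s" for \<tau>
    using q le[of "x + \<tau> *\<^sub>R (0, 1)"] le[of "x - \<tau> *\<^sub>R (0, 1)"] vd eq by (auto simp: g_def)
  have [measurable]: "g \<in> borel_measurable borel"
    unfolding g_def
    by (intro borel_measurable_diff borel_measurable_add borel_measurable_const
        measurable_compose[OF _ meas] borel_measurable_continuous_onI continuous_intros)
  \<comment> \<open>Integrability matters here: the default value 0 would not satisfy a strictly
    negative bound.\<close>
  have int: "set_integrable lebesgue {0<..} (\<lambda>\<tau>. g \<tau> / \<tau> powr (1 + 2 * s))"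
  proof (rule set_integrable_bound[OF Levy_bound_integrable[OF s \<delta>, of K "4 * M"]])
    show "set_borel_measurable lebesgue {0<..} (\<lambda>\<tau>. g \<tau> / \<tau> powr (1 + 2 * s))"
      unfolding set_borel_measurable_def by (intro measurable_completion) measurable
    show "AE \<tau> in lebesgue. \<tau> \<in> {0<..} \<longrightarrow> norm (g \<tau> / \<tau> powr (1 + 2 * s))
        \<le> norm ((if \<tau> \<le> \<delta> then K * \<tau>\<^sup>2 else 4 * M) / \<tau> powr (1 + 2 * s))"
    proof (intro AE_I2 impI)
      fix \<tau> :: real assume \<tau>: "\<tau> \<in> {0<..}"
      have "\<bar>g \<tau>\<bar> \<le> 4 * M"
        using bounded[of "x + \<tau> *\<^sub>R (0, 1)"] bounded[of "x - \<tau> *\<^sub>R (0, 1)"] bounded[of x]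
        unfolding g_def by linarith
      then have "\<bar>g \<tau>\<bar> \<le> \<bar>if \<tau> \<le> \<delta> then K * \<tau>\<^sup>2 else 4 * M\<bar>"
        using near[of \<tau>] \<tau> by (auto simp: g_def intro: order_trans[OF _ abs_ge_self])
      then show "norm (g \<tau> / \<tau> powr (1 + 2 * s))
        \<le> norm ((if \<tau> \<le> \<delta> then K * \<tau>\<^sup>2 else 4 * M) / \<tau> powr (1 + 2 * s))"
        unfolding real_norm_def abs_divide by (intro divide_right_mono) auto
    qed
  qed
  have "(LINT \<tau>:{0<..}|lebesgue. g \<tau> / \<tau> powr (1 + 2 * s))
    \<le> - (\<rho> powr (- s) * (2 powr (- s) - 2 powr (- 2 * s)) / s)"
  proof (rule cap_integral_le[OF s d int])
    fix \<tau> :: real assume "0 < \<tau>" "\<tau> < 2 * \<rho>"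
    then show "g \<tau> \<le> (d + \<tau>) powr s + max 0 (d - \<tau>) powr s - 2 * d powr s"
      using g_le[of \<tau>] out[of \<tau>] inw[of \<tau>] by linarith
  next
    fix \<tau> :: real
    show "g \<tau> \<le> 2 * \<rho> powr s - 2 * d powr s"
      using g_le[of \<tau>] comb_le[OF s(1) \<rho>, of "snd x + q * \<tau>"] comb_le[OF s(1) \<rho>, of "snd x - q * \<tau>"]
      by linarith
  qed
  from mult_left_mono[OF this c] show ?thesis by (simp add: dir_op_def g_def)
qed

text \<open>\<open>small\<close> makes the gain in the vertical direction at least 1, while
  \<open>\<rho> \<le> 1\<close> keeps \<open>u\<close> and hence its power p at most 1.\<close>

lemma comb_supersolution:
  fixes c s p \<rho> :: real and k :: nat
  assumes s: "0 < s" "s < 1" and c: "0 < c" and p: "0 < p" and \<rho>: "0 < \<rho>" "\<rho> \<le> 1"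
    and small: "1 \<le> c * (\<rho> powr (- s) * (2 powr (- s) - 2 powr (- 2 * s)) / s)"
    and k: "0 < k" "k \<le> DIM('a::euclidean_space)"
  shows "viscosity_supersolution s (inf_op c s k) p (\<lambda>x::'a \<times> real. comb s \<rho> (snd x))"
proof -
  define u where "u = (\<lambda>x::'a \<times> real. comb s \<rho> (snd x))"
  have u_cont: "continuous_on S u" for S
    unfolding u_def using s by (intro continuous_intros)
  have u_bounds: "0 \<le> u y" "u y \<le> \<rho> powr s" for y
    using comb_nonneg comb_le s \<rho> by (auto simp: u_def)
  have u_S: "u \<in> class_S s"
    unfolding class_S_def
  proof (intro CollectI conjI ballI allI impI)
    fix x \<xi> :: "'a \<times> real"
    have "(\<lambda>\<tau>. u (x + \<tau> *\<^sub>R \<xi>)) \<in> borel_measurable borel"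
      unfolding u_def using s by (intro borel_measurable_continuous_onI continuous_intros)
    then show "(\<lambda>\<tau>. u (x + \<tau> *\<^sub>R \<xi>)) \<in> borel_measurable lebesgue"
      by (intro measurable_completion) simp
    show "\<exists>\<alpha> K. 0 \<le> \<alpha> \<and> \<alpha> < 2 * s \<and> 0 < K \<and> (\<forall>x. \<bar>u x\<bar> \<le> K * (1 + norm x) powr \<alpha>)"
      using u_bounds s \<rho> by (intro exI[of _ 0] exI[of _ "\<rho> powr s"]) (auto simp: add_pos_nonneg add_nonneg_eq_0_iff)
  qed
  have u_LSC: "u \<in> LSC half_space"
    using u_cont[of half_space] by (auto simp: LSC_def continuous_on intro: order_tendstoD(1))
  have touching: "inf_op c s k (\<lambda>x. if x \<in> ball x0 r then \<phi> x else u x) x0 + u x0 powr p \<le> 0"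
    if r: "0 < r" and C2: "C2_closure (ball x0 r) \<phi>" and eq: "\<phi> x0 = u x0"
      and le: "\<And>x. x \<in> ball x0 r \<Longrightarrow> \<phi> x \<le> u x"
    for x0 r \<phi>
  proof -
    define v where "v = (\<lambda>x. if x \<in> ball x0 r then \<phi> x else u x)"
    have v_le: "v y \<le> u y" for y using le by (simp add: v_def)
    have v_eq: "v x0 = u x0" using r eq by (simp add: v_def)
    obtain K \<delta> where \<delta>: "0 < \<delta>" "\<delta> < r"
      and \<phi>: "\<And>\<xi> \<tau>. norm \<xi> = 1 \<Longrightarrow> 0 < \<tau> \<Longrightarrow> \<tau> \<le> \<delta> \<Longrightarrow>
      \<bar>\<phi> (x0 + \<tau> *\<^sub>R \<xi>) + \<phi> (x0 - \<tau> *\<^sub>R \<xi>) - 2 * \<phi> x0\<bar> \<le> K * \<tau>\<^sup>2"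
      using C2_second_difference[OF C2 r] by metis
    have near: "\<bar>v (x0 + \<tau> *\<^sub>R \<xi>) + v (x0 - \<tau> *\<^sub>R \<xi>) - 2 * v x0\<bar> \<le> K * \<tau>\<^sup>2"
      if "norm \<xi> = 1" "0 < \<tau>" "\<tau> \<le> \<delta>" for \<xi> \<tau>
      using \<phi>[OF that] that \<delta> r by (simp add: v_def dist_norm)
    have \<phi>_cont: "continuous_on (cball x0 r) \<phi>"
      using C2 r by (auto simp: C2_closure_def C2_derivs_def)
    obtain M0 where M0: "\<And>y. y \<in> cball x0 r \<Longrightarrow> \<bar>\<phi> y\<bar> \<le> M0"
      using compact_imp_bounded[OF compact_continuous_image[OF \<phi>_cont compact_cball]]
      unfolding bounded_iff by (metis imageI real_norm_def)
    have M: "\<bar>v y\<bar> \<le> max M0 (\<rho> powr s)" for y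
      using M0[of y] u_bounds[of y] by (auto simp: v_def)
    have meas: "v \<in> borel_measurable borel"
      unfolding v_def
      by (intro borel_measurable_continuous_on_if u_cont continuous_on_subset[OF \<phi>_cont]) auto
    have inf_le: "inf_op c s k v x0 \<le> (\<Sum>\<xi>\<in>B. dir_op c s \<xi> v x0)"
      if "B \<in> orthonormal_families k" for B
      by (rule inf_op_le[OF s less_imp_le[OF c] \<delta>(1) _ M that]) (rule near)
    \<comment> \<open>\<open>u\<close> is constant along these directions, so
      \<open>v \<le> u\<close> with equality at \<open>x0\<close> gives \<open>v\<close> a maximum
      at \<open>x0\<close> on each such line.\<close>
    have horizontal: "(\<Sum>\<xi>\<in>B. dir_op c s \<xi> v x0) \<le> 0" if "B \<subseteq> (\<lambda>b. (b, 0)) ` Basis" for B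
    proof (rule sum_nonpos, rule dir_op_nonpos)
      fix \<xi> \<tau> assume "\<xi> \<in> B" "0 < (\<tau>::real)"
      then have "u (x0 + \<tau> *\<^sub>R \<xi>) = u x0" "u (x0 - \<tau> *\<^sub>R \<xi>) = u x0" using that by (auto simp: u_def)
      then show "v (x0 + \<tau> *\<^sub>R \<xi>) + v (x0 - \<tau> *\<^sub>R \<xi>) \<le> 2 * v x0"
        using v_le[of "x0 + \<tau> *\<^sub>R \<xi>"] v_le[of "x0 - \<tau> *\<^sub>R \<xi>"] v_eq by simp
    qed (use c in simp)
    have "inf_op c s k v x0 + u x0 powr p \<le> 0"
    proof (cases "u x0 = 0")
      \<comment> \<open>The power term vanishes. All k directions are taken horizontal, for which k
        \<le> N - 1 is exactly what is needed.\<close>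
      case True
      obtain B where B: "B \<subseteq> (\<lambda>b::'a. (b, 0::real)) ` Basis" "card B = k"
        using horizontal_frame[OF k(2)] .
      then have "B \<in> orthonormal_families k"
        using Basis_subset_orthonormal[of B] by (auto simp: Basis_prod_def)
      then show ?thesis using inf_le[of B] horizontal[OF B(1)] True p by simp
    next
      case False
      have "k - 1 \<le> DIM('a)" using k by simp
      then obtain B0 where B0: "B0 \<subseteq> (\<lambda>b::'a. (b, 0::real)) ` Basis" "card B0 = k - 1"
        by (rule horizontal_frame)
      \<comment> \<open>The vertical direction provides the gain; the k - 1 horizontal ones can only
        lower the sum.\<close>
      define B where "B = insert (0, 1) B0"
      have fin: "finite B0" using finite_subset[OF B0(1)] by simp
      have notin: "(0, 1) \<notin> B0" using B0(1) by auto
      have "B \<subseteq> Basis" using B0(1) by (auto simp: B_def Basis_prod_def)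
      moreover have "card B = k" using fin notin B0 k by (simp add: B_def)
      ultimately have "B \<in> orthonormal_families k" using Basis_subset_orthonormal by blast
      then have "inf_op c s k v x0 \<le> (\<Sum>\<xi>\<in>B. dir_op c s \<xi> v x0)" by (rule inf_le)
      also have "\<dots> = dir_op c s (0, 1) v x0 + (\<Sum>\<xi>\<in>B0. dir_op c s \<xi> v x0)"
        using fin notin by (simp add: B_def)
      also have "\<dots> \<le> dir_op c s (0, 1) v x0" using horizontal[OF B0(1)] by simp
      also have "\<dots> \<le> - (c * (\<rho> powr (- s) * (2 powr (- s) - 2 powr (- 2 * s)) / s))"
      proof (rule comb_dir_op_le[OF s less_imp_le[OF c] \<rho>(1) \<delta>(1) meas near M])
        show "0 < v x0" using False u_bounds(1)[of x0] v_eq by simp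
      qed (use v_le v_eq in \<open>auto simp: u_def norm_Pair\<close>)
      also have "\<dots> \<le> - 1" using small by simp
      finally have "inf_op c s k v x0 \<le> - 1" .
      moreover have "u x0 \<le> 1"
        using u_bounds(2)[of x0] powr_mono2[of s \<rho> 1] s \<rho> by simp
      then have "u x0 powr p \<le> 1" using powr_mono2[of p "u x0" 1] u_bounds(1)[of x0] p by simp
      ultimately show ?thesis by simp
    qed
    then show ?thesis by (simp add: v_def)
  qed
  have "viscosity_supersolution s (inf_op c s k) p u"
    unfolding viscosity_supersolution_def
  proof (intro conjI IntI u_S u_LSC ballI allI impI)
    fix x0 r \<phi>
    assume "0 < (r::real)"
      and "ball x0 r \<subseteq> half_space \<and> C2_closure (ball x0 r) \<phi> \<and> \<phi> x0 = u x0 \<and>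
        (\<forall>x\<in>ball x0 r. \<phi> x \<le> u x)"
    then show "inf_op c s k (\<lambda>x. if x \<in> ball x0 r then \<phi> x else u x) x0 + u x0 powr p \<le> 0"
      by (intro touching) simp_all
  qed
  then show ?thesis unfolding u_def .
qed

section \<open>Choice of the scale and conclusion\<close>

theorem theorem1p3:
  fixes C :: "real \<Rightarrow> real" and s p :: real and k :: nat
  assumes "normalizing TYPE((real ^ 'm) \<times> real) C"
    and "2 \<le> DIM((real ^ 'm) \<times> real)"
    and "0 < s" and "s < 1"
    and "0 < k" and "k < DIM((real ^ 'm) \<times> real)"
    and "0 < p"
  shows "\<exists>u :: (real ^ 'm) \<times> real \<Rightarrow> real.
           (\<forall>x. 0 \<le> u x) \<and>
           u \<in> holder_space s \<inter> L_infty \<and>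
           viscosity_supersolution s (inf_op (C s) s k) p u \<and>
           (\<forall>x. x \<notin> half_space \<longrightarrow> u x = 0) \<and>
           (\<exists>c>0. \<forall>x'. ereal c \<le> Limsup at_top (\<lambda>t. ereal (u (x', t))))"
proof -
  note s = \<open>0 < s\<close> \<open>s < 1\<close>
  have C: "0 < C s" using assms by (simp add: normalizing_def)
  define \<kappa> where "\<kappa> = C s * ((2 powr (- s) - 2 powr (- 2 * s)) / s)"
  have "2 powr (- 2 * s) < 2 powr (- s)" using s by (intro powr_less_mono) auto
  then have \<kappa>: "0 < \<kappa>" using C s by (simp add: \<kappa>_def)
  \<comment> \<open>The gain is \<open>\<kappa> * \<rho> powr (- s)\<close>, so it reaches 1 once
    \<open>\<rho> powr s \<le> \<kappa>\<close>.\<close>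
  define \<rho> where "\<rho> = min 1 (\<kappa> powr (1 / s))"
  have \<rho>: "0 < \<rho>" "\<rho> \<le> 1" using \<kappa> by (auto simp: \<rho>_def)
  have "\<rho> powr s \<le> (\<kappa> powr (1 / s)) powr s"
    using s \<rho> by (intro powr_mono2) (auto simp: \<rho>_def)
  then have "\<rho> powr s \<le> \<kappa>" using s \<kappa> by (simp add: powr_powr)
  then have "1 \<le> \<kappa> * \<rho> powr (- s)" using \<rho> by (simp add: powr_minus field_simps)
  then have small: "1 \<le> C s * (\<rho> powr (- s) * (2 powr (- s) - 2 powr (- 2 * s)) / s)"
    by (simp add: \<kappa>_def mult_ac)
  define u where "u = (\<lambda>x::(real ^ 'm) \<times> real. comb s \<rho> (snd x))"
  have "viscosity_supersolution s (inf_op (C s) s k) p u"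
    unfolding u_def using s C \<open>0 < p\<close> \<rho> small \<open>0 < k\<close> assms(6) by (intro comb_supersolution) auto
  moreover have "u \<in> holder_space s"
    unfolding holder_space_def u_def
  proof (intro CollectI exI[of _ 1] allI)
    fix x y :: "(real ^ 'm) \<times> real"
    have "\<bar>comb s \<rho> (snd x) - comb s \<rho> (snd y)\<bar> \<le> \<bar>snd x - snd y\<bar> powr s"
      using s by (rule comb_holder)
    also have "\<dots> \<le> dist x y powr s"
      using s dist_snd_le[of x y] by (intro powr_mono2) (auto simp: dist_real_def)
    finally show "\<bar>comb s \<rho> (snd x) - comb s \<rho> (snd y)\<bar> \<le> 1 * dist x y powr s" by simp
  qed
  moreover have "u \<in> L_infty"
  proof -
    have "u \<in> borel_measurable borel"
      unfolding u_def using s by (intro borel_measurable_continuous_onI continuous_intros)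
    then have "u \<in> borel_measurable lebesgue"
      by (intro measurable_completion) simp
    moreover have "\<bar>u x\<bar> \<le> \<rho> powr s" for x
      using comb_nonneg comb_le s \<rho> by (simp add: u_def)
    ultimately show ?thesis unfolding L_infty_def by blast
  qed
  moreover have "\<forall>x. x \<notin> half_space \<longrightarrow> u x = 0"
    using comb_nonpos[OF \<rho>(1)] by (simp add: u_def half_space_def)
  moreover have "\<exists>c>0. \<forall>x'. ereal c \<le> Limsup at_top (\<lambda>t. ereal (u (x', t)))"
  \<comment> \<open>The peak height is attained at arbitrarily large centres, at the same heights
    for all x', hence the uniform constant.\<close>
  proof (intro exI[of _ "\<rho> powr s"] conjI allI)
    show "0 < \<rho> powr s" using \<rho> by simp
    fix x'
    show "ereal (\<rho> powr s) \<le> Limsup at_top (\<lambda>t. ereal (u (x', t)))"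
      unfolding Limsup_def
    proof (rule INF_greatest)
      fix P :: "real \<Rightarrow> bool" assume "P \<in> {P. eventually P at_top}"
      then obtain N where N: "\<And>t. N \<le> t \<Longrightarrow> P t" by (auto simp: eventually_at_top_linorder)
      obtain n where "N < real n * (4 * \<rho>)" using reals_Archimedean3[of "4 * \<rho>"] \<rho> by auto
      also have "\<dots> \<le> 4 * \<rho> * real (Suc n)" using \<rho> by simp
      finally have "P (4 * \<rho> * real (Suc n))" by (intro N) simp
      moreover have "u (x', 4 * \<rho> * real (Suc n)) = \<rho> powr s"
        unfolding u_def snd_conv by (rule comb_centre[OF \<rho>(1)]) (unfold comb_centres_def, rule rangeI)
      ultimately show "ereal (\<rho> powr s) \<le> (SUP t\<in>{t. P t}. ereal (u (x', t)))"
        by (intro SUP_upper2[of "4 * \<rho> * real (Suc n)"]) auto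
    qed
  qed
  moreover have "\<forall>x. 0 \<le> u x" by (simp add: u_def comb_nonneg)
  ultimately show ?thesis by (intro exI[of _ u]) simp
qed

end
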